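(* Let $A \in \mathbb{Z}^{m \times n}$, let $K \subset \mathbb{R}^m$ be a closed, convex, and pointed cone, and let $\mathbf{H}$ be a bounded subset of $\mathbb{Z}^m$. There exists a finite $\bar{k}\in\mathbb{Z}_+$ such that for all $k\ge\bar{k}$ and all $\beta\in\mathbf{H}$, $F_+^k(\beta)=F_+(\beta)$. If $\{u\in K^* : A^Tu\ge 1\}\neq\emptyset$, then $\bar{k}$ can be computed by solving a (continuous) conic feasibility problem using the data $(A, 1, 0, K^* )$, and taking the maximum of $|\mathbf{H}|$ inner products.
   Context: For $\beta^1,\beta^2\in\mathbb{R}^m$, $\beta^1 \preceq_K \beta^2$ means $\beta^2-\beta^1 \in K$. $\mathbb{Z}_+$ denotes the nonnegative integers; $k$ ranges over $\mathbb{Z}_+$. The symbol $1$ also denotes the all-ones vector, and $A^Tu\ge 1$ is meant componentwise. The dual cone of $K$ is $K^*=\{h\in\mathbb{R}^m : h^T\beta\ge 0\ \text{for all } \beta\in K\}$. The conic feasibility problem with data $(A,1,0,K^* )$ is the problem $\min\{0^Tu : A^Tu\ge 1,\ u\in K^*\}$, i.e. finding $u\in K^*$ with $A^Tu\ge 1$. For $\beta\in\mathbb{R}^m$ and $k\in\mathbb{Z}_+$, let $\mathbf{P}_+(\beta)=\{x : Ax\preceq_K\beta,\ x\in\mathbb{Z}^n_+\}$ and $\mathbf{P}_+^k(\beta)=\{x : Ax\preceq_K\beta,\ x\in\mathbb{Z}^n_+,\ 1^Tx\le k\}$. The function $F_+:\mathbb{R}^m\to\mathbb{R}$ is defined by $F_+(\beta)=0$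 if $\mathbf{P}_+(\beta)\ne\emptyset$ and $F_+(\beta)=-1$ if $\mathbf{P}_+(\beta)=\emptyset$; the function $F_+^k$ is defined by $F_+^k(\beta)=0$ if $\mathbf{P}_+^k(\beta)\neq\emptyset$ and $F_+^k(\beta)=-1$ if $\mathbf{P}_+^k(\beta)=\emptyset$. *)

theory Defs
  imports "HOL-Analysis.Analysis"
begin

definition pointed :: "'a::ab_group_add set \<Rightarrow> bool" where
  "pointed K \<longleftrightarrow> K \<inter> uminus ` K = {0}"

definition dual_cone :: "'a::real_inner set \<Rightarrow> 'a set" where
  "dual_cone K = {h. \<forall>\<beta>\<in>K. 0 \<le> h \<bullet> \<beta>}"

definition cone_le :: "'a::ab_group_add set \<Rightarrow> 'a \<Rightarrow> 'a \<Rightarrow> bool" where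
  "cone_le K \<beta>1 \<beta>2 \<longleftrightarrow> \<beta>2 - \<beta>1 \<in> K"

definition int_vecs :: "(real ^ 'n) set" where
  "int_vecs = {x. \<forall>i. x $ i \<in> \<int>}"

definition nonneg_int_vecs :: "(real ^ 'n) set" where
  "nonneg_int_vecs = {x \<in> int_vecs. 0 \<le> x}"

definition P_plus :: "real ^ 'n ^ 'm \<Rightarrow> (real ^ 'm) set \<Rightarrow> real ^ 'm \<Rightarrow> (real ^ 'n) set" where
  "P_plus A K \<beta> = {x \<in> nonneg_int_vecs. cone_le K (A *v x) \<beta>}"

definition P_plus_k ::
  "real ^ 'n ^ 'm \<Rightarrow> (real ^ 'm) set \<Rightarrow> nat \<Rightarrow> real ^ 'm \<Rightarrow> (real ^ 'n) set" where
  "P_plus_k A K k \<beta> = {x \<in> nonneg_int_vecs. cone_le K (A *v x) \<beta> \<and> 1 \<bullet> x \<le> real k}"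

definition F_plus :: "real ^ 'n ^ 'm \<Rightarrow> (real ^ 'm) set \<Rightarrow> real ^ 'm \<Rightarrow> real" where
  "F_plus A K \<beta> = (if P_plus A K \<beta> \<noteq> {} then 0 else -1)"

definition F_plus_k ::
  "real ^ 'n ^ 'm \<Rightarrow> (real ^ 'm) set \<Rightarrow> nat \<Rightarrow> real ^ 'm \<Rightarrow> real" where
  "F_plus_k A K k \<beta> = (if P_plus_k A K k \<beta> \<noteq> {} then 0 else -1)"

text \<open>The conic problem with data \<open>(A, b, c, C)\<close> is to minimise \<open>c \<bullet> u\<close> subject to
  \<open>A\<^sup>T u \<ge> b\<close> and \<open>u \<in> C\<close>; the order on vectors is componentwise. For \<open>c = 0\<close> every
  feasible point is a solution.\<close>

definition conic_feasible_set ::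
  "real ^ 'n ^ 'm \<Rightarrow> real ^ 'n \<Rightarrow> (real ^ 'm) set \<Rightarrow> (real ^ 'm) set" where
  "conic_feasible_set A b C = {u \<in> C. b \<le> transpose A *v u}"

definition conic_solution ::
  "real ^ 'n ^ 'm \<Rightarrow> real ^ 'n \<Rightarrow> real ^ 'm \<Rightarrow> (real ^ 'm) set \<Rightarrow> real ^ 'm \<Rightarrow> bool" where
  "conic_solution A b c C u \<longleftrightarrow>
     is_arg_min (\<lambda>v. c \<bullet> v) (\<lambda>v. v \<in> conic_feasible_set A b C) u"

definition valid_bound ::
  "real ^ 'n ^ 'm \<Rightarrow> (real ^ 'm) set \<Rightarrow> (real ^ 'm) set \<Rightarrow> nat \<Rightarrow> bool" where
  "valid_bound A K H kbar \<longleftrightarrow>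
     (\<forall>k\<ge>kbar. \<forall>\<beta>\<in>H. F_plus_k A K k \<beta> = F_plus A K \<beta>)"

text \<open>The inner products are real, so their maximum is rounded down to an integer. If the maximum
  is negative, \<open>nat\<close> truncates it to \<open>0\<close>, the smallest admissible bound. For
  \<open>H = {}\<close>, where the maximum is unspecified, every natural number is a valid bound.\<close>

definition inner_product_bound :: "(real ^ 'm) set \<Rightarrow> real ^ 'm \<Rightarrow> nat" where
  "inner_product_bound H u = nat \<lfloor>Max ((\<lambda>\<beta>. u \<bullet> \<beta>) ` H)\<rfloor>"

end

theory Submission
  imports Defs
begin

text \<open>A bounded set of integer vectors is finite, so the first claim only needs one point of each
  nonempty \<open>P_plus A K \<beta>\<close>. For the second claim, every \<open>x \<in> P_plus A K \<beta>\<close> and every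
  feasible \<open>u\<close> satisfy \<open>1 \<bullet> x \<le> (A\<^sup>T u) \<bullet> x = u \<bullet> A x \<le> u \<bullet> \<beta>\<close>, and
  \<open>1 \<bullet> x\<close> is an integer.\<close>

text \<open>The norm bounds every entry, and an integer entry equals its floor. So each vector of
  \<open>H\<close> is the image of a function from the finite index type into one fixed integer
  interval.\<close>

lemma finite_bounded_int_vecs:
  fixes H :: "(real ^ 'm) set"
  assumes "bounded H" and "H \<subseteq> int_vecs"
  shows "finite H"
proof -
  obtain B where B: "\<And>x. x \<in> H \<Longrightarrow> norm x \<le> B"
    using \<open>bounded H\<close> unfolding bounded_iff by blast
  let ?F = "UNIV \<rightarrow>\<^sub>E {- \<lceil>B\<rceil>..\<lceil>B\<rceil>} :: ('m \<Rightarrow> int) set"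
  have "H \<subseteq> (\<lambda>f. \<chi> i. of_int (f i)) ` ?F"
  proof
    fix x assume "x \<in> H"
    have eq: "of_int \<lfloor>x $ i\<rfloor> = x $ i" for i
      using \<open>x \<in> H\<close> \<open>H \<subseteq> int_vecs\<close> by (auto simp: int_vecs_def elim!: Ints_cases)
    have "\<bar>\<lfloor>x $ i\<rfloor>\<bar> \<le> \<lceil>B\<rceil>" for i
    proof -
      have "\<bar>x $ i\<bar> \<le> B"
        using component_le_norm_cart B[OF \<open>x \<in> H\<close>] by (rule order_trans)
      then have "of_int \<bar>\<lfloor>x $ i\<rfloor>\<bar> \<le> B"
        by (simp add: eq)
      then show ?thesis
        by linarith
    qed
    then have "(\<lambda>i. \<lfloor>x $ i\<rfloor>) \<in> ?F"
      by (auto simp: abs_le_iff minus_le_iff)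
    moreover have "x = (\<chi> i. of_int \<lfloor>x $ i\<rfloor>)"
      by (simp add: eq vec_eq_iff)
    ultimately show "x \<in> (\<lambda>f. \<chi> i. of_int (f i)) ` ?F"
      by (intro image_eqI[where x = "\<lambda>i. \<lfloor>x $ i\<rfloor>"])
  qed
  then show ?thesis
    by (rule finite_subset) (intro finite_imageI finite_PiE; simp)
qed

text \<open>Since \<open>P_plus_k\<close> is contained in \<open>P_plus\<close>, the two values can
  differ only where \<open>P_plus\<close> is nonempty. There a single point with small coordinate
  sum suffices, and it stays admissible for every larger \<open>k\<close>.\<close>

lemma valid_boundI:
  assumes "\<And>\<beta>. \<beta> \<in> H \<Longrightarrow> P_plus A K \<beta> \<noteq> {} \<Longrightarrow> \<exists>x\<in>P_plus A K \<beta>. 1 \<bullet> x \<le> real kbar"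
  shows "valid_bound A K H kbar"
  unfolding valid_bound_def
proof (intro allI impI ballI)
  fix k \<beta> assume k: "kbar \<le> k" and "\<beta> \<in> H"
  have "P_plus_k A K k \<beta> \<noteq> {} \<longleftrightarrow> P_plus A K \<beta> \<noteq> {}"
  proof
    show "P_plus_k A K k \<beta> \<noteq> {} \<Longrightarrow> P_plus A K \<beta> \<noteq> {}"
      by (auto simp: P_plus_k_def P_plus_def)
  next
    assume "P_plus A K \<beta> \<noteq> {}"
    then obtain x where x: "x \<in> P_plus A K \<beta>" "1 \<bullet> x \<le> real kbar"
      using assms \<open>\<beta> \<in> H\<close> by blast
    have "1 \<bullet> x \<le> real k"
      using x(2) k by linarith
    with x(1) show "P_plus_k A K k \<beta> \<noteq> {}"
      by (auto simp: P_plus_k_def P_plus_def)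
  qed
  then show "F_plus_k A K k \<beta> = F_plus A K \<beta>"
    by (simp add: F_plus_k_def F_plus_def)
qed

lemma ex_valid_bound:
  assumes "finite H"
  shows "\<exists>kbar. valid_bound A K H kbar"
proof -
  \<comment> \<open>The choice is arbitrary where \<open>P_plus A K \<beta>\<close> is empty; such
    \<beta> need no witness.\<close>
  define x where "x \<beta> = (SOME x. x \<in> P_plus A K \<beta>)" for \<beta>
  \<comment> \<open>A sum of naturals dominates each of its terms and, unlike a maximum, needs no
    separate case for empty \<open>H\<close>.\<close>
  define kbar where "kbar = (\<Sum>\<beta>\<in>H. nat \<lceil>1 \<bullet> x \<beta>\<rceil>)"
  have "valid_bound A K H kbar"
  proof (rule valid_boundI)
    fix \<beta> assume "\<beta> \<in> H" and "P_plus A K \<beta> \<noteq> {}"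
    then have "x \<beta> \<in> P_plus A K \<beta>"
      unfolding x_def by (simp add: some_in_eq)
    moreover have "nat \<lceil>1 \<bullet> x \<beta>\<rceil> \<le> kbar"
      unfolding kbar_def using assms \<open>\<beta> \<in> H\<close> by (intro member_le_sum) auto
    then have "1 \<bullet> x \<beta> \<le> real kbar"
      by linarith
    ultimately show "\<exists>x\<in>P_plus A K \<beta>. 1 \<bullet> x \<le> real kbar"
      by blast
  qed
  then show ?thesis ..
qed

lemma conic_solution_zero_iff:
  "conic_solution A b 0 C u \<longleftrightarrow> u \<in> conic_feasible_set A b C"
  by (simp add: conic_solution_def is_arg_min_def)

lemma one_inner_int_vecs:
  assumes "x \<in> int_vecs"
  shows "1 \<bullet> x \<in> \<int>"
  using assms by (auto simp: inner_vec_def int_vecs_def intro: Ints_sum)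

lemma one_inner_le_feasible_inner:
  fixes A :: "real ^ 'n ^ 'm"
  assumes u: "u \<in> conic_feasible_set A 1 (dual_cone K)" and x: "x \<in> P_plus A K \<beta>"
  shows "1 \<bullet> x \<le> u \<bullet> \<beta>"
proof -
  have "1 \<bullet> x \<le> (transpose A *v u) \<bullet> x"
    unfolding inner_vec_def
  proof (rule sum_mono)
    fix i
    have "1 $ i \<le> (transpose A *v u) $ i" and "0 \<le> x $ i"
      using u x
      by (auto simp: conic_feasible_set_def P_plus_def nonneg_int_vecs_def less_eq_vec_def)
    then show "1 $ i \<bullet> x $ i \<le> (transpose A *v u) $ i \<bullet> x $ i"
      unfolding inner_real_def by (rule mult_right_mono)
  qed
  also have "\<dots> = u \<bullet> (A *v x)"
    by (simp add: dot_lmul_matrix flip: vector_transpose_matrix)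
  \<comment> \<open>Membership of \<open>u\<close> in the dual cone is applied to the slack
    \<open>\<beta> - A *v x\<close>, which lies in \<open>K\<close>.\<close>
  also have "\<dots> \<le> u \<bullet> \<beta>"
    using u x
    by (auto simp: conic_feasible_set_def P_plus_def cone_le_def dual_cone_def inner_diff_right)
  finally show ?thesis .
qed

lemma valid_bound_inner_product_bound:
  fixes A :: "real ^ 'n ^ 'm"
  assumes "finite H" and u: "u \<in> conic_feasible_set A 1 (dual_cone K)"
  shows "valid_bound A K H (inner_product_bound H u)"
proof (rule valid_boundI)
  fix \<beta> assume "\<beta> \<in> H" and "P_plus A K \<beta> \<noteq> {}"
  then obtain x where x: "x \<in> P_plus A K \<beta>"
    by blast
  obtain z where z: "1 \<bullet> x = real_of_int z"
    using x one_inner_int_vecs[of x]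
    by (auto simp: P_plus_def nonneg_int_vecs_def elim: Ints_cases)
  have "1 \<bullet> x \<le> u \<bullet> \<beta>"
    by (rule one_inner_le_feasible_inner[OF u x])
  \<comment> \<open>\<open>Max\<close> is meaningful here: \<open>H\<close> is finite, and it
    contains \<beta>.\<close>
  also have "\<dots> \<le> Max ((\<lambda>\<beta>. u \<bullet> \<beta>) ` H)"
    using \<open>finite H\<close> \<open>\<beta> \<in> H\<close> by simp
  \<comment> \<open>Rounding down loses nothing because \<open>z\<close> is an integer; the later
    truncation by \<open>nat\<close> can only raise the bound.\<close>
  finally have "z \<le> \<lfloor>Max ((\<lambda>\<beta>. u \<bullet> \<beta>) ` H)\<rfloor>"
    by (simp add: z le_floor_iff)
  then have "1 \<bullet> x \<le> real (inner_product_bound H u)"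
    unfolding inner_product_bound_def z by linarith
  with x show "\<exists>x\<in>P_plus A K \<beta>. 1 \<bullet> x \<le> real (inner_product_bound H u)"
    by blast
qed

theorem proposition14:
  fixes A :: "real ^ 'n ^ 'm" and K H :: "(real ^ 'm) set"
  assumes "\<And>i j. A $ i $ j \<in> \<int>"
    and "closed K" and "convex K" and "cone K" and "pointed K"
    and "bounded H" and "H \<subseteq> int_vecs"
  shows "(\<exists>kbar. valid_bound A K H kbar) \<and>
    (conic_feasible_set A 1 (dual_cone K) \<noteq> {} \<longrightarrow>
      finite H \<and>
      (\<exists>u. conic_solution A 1 0 (dual_cone K) u) \<and>
      (\<forall>u. conic_solution A 1 0 (dual_cone K) u \<longrightarrow>
        valid_bound A K H (inner_product_bound H u)))"
proof -
  \<comment> \<open>Finiteness serves both claims: it makes the sum of witness sizes finite and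
    leaves only finitely many inner products to compare. With objective \<open>0\<close>, a solution
    exists as soon as a feasible point does.\<close>
  have "finite H"
    using \<open>bounded H\<close> \<open>H \<subseteq> int_vecs\<close> by (rule finite_bounded_int_vecs)
  then show ?thesis
    by (auto simp: conic_solution_zero_iff
        intro: ex_valid_bound valid_bound_inner_product_bound)
qed

end
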